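(* Let $n,k,s$ be positive integers with $n\geq k^2s^2$. Then the sequence $(f_1,\ldots,f_s)$ with $f_i=\min(s-1,i)\,n^{k-1}$, $i\in[s]$, is satisfying; that is, whenever $\mathcal F_1,\ldots,\mathcal F_s\subset[n]^k$ satisfy $|\mathcal F_i|>\min(s-1,i)\,n^{k-1}$ for every $i\in[s]$, there exist pairwise disjoint $F_1\in\mathcal F_1,\ldots,F_s\in\mathcal F_s$.
   Context: $[n]=\{1,\ldots,n\}$ and $[n]^k$ is the set of all $k$-tuples $(x_1,\ldots,x_k)$ with $x_j\in[n]$. A tuple $(x_1,\ldots,x_k)$ is identified with the $k$-element set $\{(1,x_1),\ldots,(k,x_k)\}\subset[k]\times[n]$; thus two tuples $x,y$ are disjoint iff $x_j\neq y_j$ for all $j\in[k]$. A sequence of reals $(f_1,\ldots,f_s)$ is satisfying if for all families $\mathcal F_1,\ldots,\mathcal F_s\subset[n]^k$ with $|\mathcal F_i|>f_i$ for each $i$, there exist pairwise disjoint $F_1\in\mathcal F_1,\ldots,F_s\in\mathcal F_s$. *)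

theory Defs
  imports Complex_Main "HOL-Library.FuncSet" "HOL-Library.Disjoint_Sets"
begin

definition tuples :: "nat \<Rightarrow> nat \<Rightarrow> (nat \<Rightarrow> nat) set" where
  "tuples n k = {1..k} \<rightarrow>\<^sub>E {1..n}"

(* The k-element subset {(1, x_1), ..., (k, x_k)} of [k] x [n] with which a tuple is
   identified; disjointness of tuples always means disjointness of these sets. *)
definition tuple_set :: "nat \<Rightarrow> (nat \<Rightarrow> nat) \<Rightarrow> (nat \<times> nat) set" where
  "tuple_set k x = (\<lambda>j. (j, x j)) ` {1..k}"

(* Sequences of length s are functions on nat of which only the values at 1, ..., s matter. *)
definition satisfying :: "nat \<Rightarrow> nat \<Rightarrow> nat \<Rightarrow> (nat \<Rightarrow> real) \<Rightarrow> bool" where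
  "satisfying n k s f \<longleftrightarrow>
    (\<forall>\<F> :: nat \<Rightarrow> (nat \<Rightarrow> nat) set.
      (\<forall>i\<in>{1..s}. \<F> i \<subseteq> tuples n k \<and> real (card (\<F> i)) > f i) \<longrightarrow>
      (\<exists>F. (\<forall>i\<in>{1..s}. F i \<in> \<F> i) \<and> disjoint_family_on (\<lambda>i. tuple_set k (F i)) {1..s}))"

end

theory Submission
  imports Defs
begin

text \<open>
  Induction on the number of families. Let \<open>D = (k - 1) (s - 1) n\<^bsup>k-2\<^esup>\<close>. If some
  vertex \<open>(j, a)\<close> has degree greater than \<open>D\<close> in the first family, delete it from the other
  families; each loses at most \<open>n\<^bsup>k-1\<^esup>\<close> tuples, so they satisfy the hypothesis for \<open>s - 1\<close>.
  A matching of them avoids \<open>(j, a)\<close>, so each of its \<open>s - 1\<close> tuples meets at most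
  \<open>(k - 1) n\<^bsup>k-2\<^esup>\<close> tuples through \<open>(j, a)\<close>, and the first family still has a free tuple there.
  If all degrees are at most \<open>D\<close>, a matching of the other families meets at most
  \<open>(s - 1) k D \<le> n\<^bsup>k-1\<^esup>\<close> tuples of the first family, which again leaves a free one.
\<close>

text \<open>A function with prescribed values on \<open>J\<close> is determined by its restriction
  to \<open>S - J\<close>. Taking \<open>J\<close> of size one and two bounds the tuples through one
  or two vertices.\<close>

lemma card_PiE_prescribed_le:
  assumes "finite S" "finite T" "J \<subseteq> S"
  shows "card {x \<in> S \<rightarrow>\<^sub>E T. \<forall>j\<in>J. x j = g j} \<le> card T ^ (card S - card J)"
proof -
  let ?A = "{x \<in> S \<rightarrow>\<^sub>E T. \<forall>j\<in>J. x j = g j}"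
  have "inj_on (\<lambda>x. restrict x (S - J)) ?A"
  proof (rule inj_onI)
    fix x y assume x: "x \<in> ?A" and y: "y \<in> ?A"
      and eq: "restrict x (S - J) = restrict y (S - J)"
    show "x = y"
    proof (rule PiE_ext)
      show "x \<in> S \<rightarrow>\<^sub>E T" "y \<in> S \<rightarrow>\<^sub>E T"
        using x y by auto
      fix i assume "i \<in> S"
      then show "x i = y i"
        using x y fun_cong[OF eq, of i] by (cases "i \<in> J") auto
    qed
  qed
  moreover have "(\<lambda>x. restrict x (S - J)) ` ?A \<subseteq> (S - J) \<rightarrow>\<^sub>E T"
    by auto
  moreover have "finite ((S - J) \<rightarrow>\<^sub>E T)"
    using assms by (intro finite_PiE) auto
  ultimately have "card ?A \<le> card ((S - J) \<rightarrow>\<^sub>E T)"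
    by (rule card_inj_on_le)
  also have "\<dots> = card T ^ (card S - card J)"
    using assms by (simp add: card_PiE card_Diff_subset finite_subset[OF assms(3)])
  finally show ?thesis .
qed

lemma finite_tuples: "finite (tuples n k)"
  by (simp add: tuples_def finite_PiE)

lemma card_tuples_through_vertex_le:
  assumes "j \<in> {1..k}"
  shows "card {x \<in> tuples n k. x j = a} \<le> n ^ (k - 1)"
  using card_PiE_prescribed_le[of "{1..k}" "{1..n}" "{j}" "\<lambda>_. a"] assms
  by (simp add: tuples_def)

lemma card_tuples_through_two_vertices_le:
  assumes "i \<in> {1..k}" "j \<in> {1..k}" "i \<noteq> j"
  shows "card {x \<in> tuples n k. x i = a \<and> x j = b} \<le> n ^ (k - 2)"
  using card_PiE_prescribed_le[of "{1..k}" "{1..n}" "{i, j}" "\<lambda>l. if l = i then a else b"] assms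
  by (simp add: tuples_def numeral_2_eq_2)

text \<open>Since \<open>y\<close> avoids the vertex \<open>(j, a)\<close>, agreement with
  \<open>y\<close> must occur at one of the other \<open>k - 1\<close> coordinates, and each of
  these fixes a second vertex of \<open>x\<close>.\<close>

lemma card_tuples_through_vertex_meeting_le:
  assumes "j \<in> {1..k}" "y j \<noteq> a"
  shows "card {x \<in> tuples n k. x j = a \<and> (\<exists>l\<in>{1..k}. x l = y l)} \<le> (k - 1) * n ^ (k - 2)"
proof -
  have "{x \<in> tuples n k. x j = a \<and> (\<exists>l\<in>{1..k}. x l = y l)}
      \<subseteq> (\<Union>l\<in>{1..k} - {j}. {x \<in> tuples n k. x j = a \<and> x l = y l})"
    using assms by auto
  then have "card {x \<in> tuples n k. x j = a \<and> (\<exists>l\<in>{1..k}. x l = y l)}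
      \<le> card (\<Union>l\<in>{1..k} - {j}. {x \<in> tuples n k. x j = a \<and> x l = y l})"
    by (intro card_mono) (auto simp: finite_tuples)
  also have "\<dots> \<le> (\<Sum>l\<in>{1..k} - {j}. card {x \<in> tuples n k. x j = a \<and> x l = y l})"
    by (rule card_UN_le) simp
  also have "\<dots> \<le> (\<Sum>l\<in>{1..k} - {j}. n ^ (k - 2))"
    using assms by (intro sum_mono card_tuples_through_two_vertices_le) auto
  also have "\<dots> = (k - 1) * n ^ (k - 2)"
    using assms by simp
  finally show ?thesis .
qed

text \<open>Union bound. It is applied with \<open>R i x\<close> saying that \<open>x\<close> meets
  the \<open>i\<close>-th tuple of a matching, once inside the tuples through a vertex and once
  inside the whole first family.\<close>

lemma exists_avoiding:
  fixes m c :: nat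
  assumes "finite A" "\<And>i. i < m \<Longrightarrow> card {x \<in> A. R i x} \<le> c" "m * c < card A"
  shows "\<exists>x\<in>A. \<forall>i<m. \<not> R i x"
proof (rule ccontr)
  assume "\<not> ?thesis"
  then have "A \<subseteq> (\<Union>i<m. {x \<in> A. R i x})"
    by auto
  then have "card A \<le> card (\<Union>i<m. {x \<in> A. R i x})"
    using assms(1) by (intro card_mono) auto
  also have "\<dots> \<le> (\<Sum>i<m. card {x \<in> A. R i x})"
    by (rule card_UN_le) simp
  also have "\<dots> \<le> m * c"
    using sum_bounded_above[of "{..<m}" "\<lambda>i. card {x \<in> A. R i x}" c] assms(2) by simp
  finally show False
    using assms(3) by simp
qed

text \<open>This is where the size of \<open>n\<close> enters: \<open>m * k * (k - 1) * m\<close> is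
  at most \<open>n\<close>, which supplies the missing factor of \<open>n ^ (k - 1)\<close>. The
  factor \<open>min m 1\<close> is the coefficient in the threshold of the first of
  \<open>Suc m\<close> families. If \<open>k \<le> 1\<close> or \<open>m = 0\<close>, the left side
  vanishes, so truncated subtraction does no harm.\<close>

lemma degree_bound_arith:
  fixes n k m :: nat
  assumes "k\<^sup>2 * (Suc m)\<^sup>2 \<le> n"
  shows "m * (k * ((k - 1) * m * n ^ (k - 2))) \<le> min m 1 * n ^ (k - 1)"
proof (cases "k \<le> 1 \<or> m = 0")
  case True
  then show ?thesis by auto
next
  case False
  then obtain l where k: "k = Suc (Suc l)"
    by (cases k; cases "k - 1") auto
  have "m * (k * ((k - 1) * m)) = (k * (k - 1)) * (m * m)"
    by (simp add: ac_simps)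
  also have "\<dots> \<le> (k * k) * (Suc m * Suc m)"
    by (intro mult_le_mono) auto
  also have "\<dots> \<le> n"
    using assms by (simp add: power2_eq_square)
  finally have "m * (k * ((k - 1) * m)) * n ^ l \<le> n * n ^ l"
    by (rule mult_le_mono1)
  moreover have "n ^ (k - 2) = n ^ l" "min m 1 * n ^ (k - 1) = n * n ^ l"
    using False by (simp_all add: k)
  ultimately show ?thesis
    by (simp only: mult.assoc)
qed

text \<open>Indices start at 0, so that removing the first family is the shift
  \<open>i \<mapsto> Suc i\<close>; the coefficient \<open>Suc i\<close> makes up for it.\<close>

lemma rainbow_matching:
  assumes "k\<^sup>2 * s\<^sup>2 \<le> n"
    and "\<And>i. i < s \<Longrightarrow> \<F> i \<subseteq> tuples n k"
    and "\<And>i. i < s \<Longrightarrow> min (s - 1) (Suc i) * n ^ (k - 1) < card (\<F> i)"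
  shows "\<exists>F. (\<forall>i<s. F i \<in> \<F> i) \<and>
    (\<forall>i<s. \<forall>j<s. i \<noteq> j \<longrightarrow> (\<forall>l\<in>{1..k}. F i l \<noteq> F j l))"
  using assms
proof (induction s arbitrary: \<F>)
  case 0
  then show ?case by simp
next
  case (Suc m)
  define D where "D = (k - 1) * m * n ^ (k - 2)"
  have sub0: "\<F> 0 \<subseteq> tuples n k"
    using Suc.prems(2) by simp
  have fin: "finite (\<F> i)" if "i < Suc m" for i
    using Suc.prems(2)[OF that] finite_tuples finite_subset by blast
  have "k\<^sup>2 * m\<^sup>2 \<le> k\<^sup>2 * (Suc m)\<^sup>2"
    by (intro mult_le_mono power_mono) auto
  then have n: "k\<^sup>2 * m\<^sup>2 \<le> n"
    using Suc.prems(1) by linarith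
  \<comment> \<open>Passing to \<open>m\<close> families lowers the coefficient of each remaining
    family by exactly one. The resulting slack \<open>n ^ (k - 1)\<close> pays for deleting one
    vertex.\<close>
  have big: "min (m - 1) (Suc i) * n ^ (k - 1) + n ^ (k - 1) < card (\<F> (Suc i))" if "i < m" for i
  proof -
    have "min m (Suc (Suc i)) = Suc (min (m - 1) (Suc i))"
      using that by auto
    then show ?thesis
      using Suc.prems(3)[of "Suc i"] that by simp
  qed
  have "\<exists>F x. (\<forall>i<m. F i \<in> \<F> (Suc i)) \<and>
      (\<forall>i<m. \<forall>j<m. i \<noteq> j \<longrightarrow> (\<forall>l\<in>{1..k}. F i l \<noteq> F j l)) \<and>
      x \<in> \<F> 0 \<and> (\<forall>i<m. \<not> (\<exists>l\<in>{1..k}. x l = F i l))"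
  proof (cases "\<exists>j\<in>{1..k}. \<exists>a. D < card {x \<in> \<F> 0. x j = a}")
    case True
    then obtain j a where j: "j \<in> {1..k}" and a: "D < card {x \<in> \<F> 0. x j = a}"
      by blast
    let ?\<G> = "\<lambda>i. {x \<in> \<F> (Suc i). x j \<noteq> a}"
    have large: "min (m - 1) (Suc i) * n ^ (k - 1) < card (?\<G> i)" if "i < m" for i
    proof -
      have "card (\<F> (Suc i)) = card (?\<G> i \<union> {x \<in> \<F> (Suc i). x j = a})"
        by (rule arg_cong[where f = card]) auto
      also have "\<dots> \<le> card (?\<G> i) + card {x \<in> \<F> (Suc i). x j = a}"
        by (rule card_Un_le)
      finally have "card (\<F> (Suc i)) \<le> card (?\<G> i) + card {x \<in> \<F> (Suc i). x j = a}" .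
      moreover have "card {x \<in> \<F> (Suc i). x j = a} \<le> card {x \<in> tuples n k. x j = a}"
        using Suc.prems(2)[of "Suc i"] that by (intro card_mono) (auto simp: finite_tuples)
      ultimately show ?thesis
        using big[OF that] card_tuples_through_vertex_le[OF j, of n a] by linarith
    qed
    have sub: "?\<G> i \<subseteq> tuples n k" if "i < m" for i
      using Suc.prems(2)[of "Suc i"] that by auto
    obtain F where F: "\<forall>i<m. F i \<in> ?\<G> i"
      "\<forall>i<m. \<forall>j<m. i \<noteq> j \<longrightarrow> (\<forall>l\<in>{1..k}. F i l \<noteq> F j l)"
      using Suc.IH[OF n sub large] by auto
    have "\<exists>x\<in>{x \<in> \<F> 0. x j = a}. \<forall>i<m. \<not> (\<exists>l\<in>{1..k}. x l = F i l)"
    proof (rule exists_avoiding)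
      show "finite {x \<in> \<F> 0. x j = a}"
        using fin by simp
      \<comment> \<open>\<open>D\<close> was chosen as exactly the number of tuples through
        \<open>(j, a)\<close> that \<open>m\<close> tuples avoiding this vertex can block.\<close>
      show "m * ((k - 1) * n ^ (k - 2)) < card {x \<in> \<F> 0. x j = a}"
        using a by (simp add: D_def ac_simps)
      fix i assume "i < m"
      then have "F i j \<noteq> a"
        using F(1) by auto
      moreover have "card {x \<in> {x \<in> \<F> 0. x j = a}. \<exists>l\<in>{1..k}. x l = F i l}
          \<le> card {x \<in> tuples n k. x j = a \<and> (\<exists>l\<in>{1..k}. x l = F i l)}"
        using sub0 by (intro card_mono) (auto simp: finite_tuples)
      ultimately show "card {x \<in> {x \<in> \<F> 0. x j = a}. \<exists>l\<in>{1..k}. x l = F i l}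
          \<le> (k - 1) * n ^ (k - 2)"
        using card_tuples_through_vertex_meeting_le[OF j, of "F i" a n] by linarith
    qed
    with F show ?thesis by blast
  next
    case False
    have large: "min (m - 1) (Suc i) * n ^ (k - 1) < card (\<F> (Suc i))" if "i < m" for i
      using big[OF that] by simp
    have sub: "\<F> (Suc i) \<subseteq> tuples n k" if "i < m" for i
      using Suc.prems(2) that by simp
    obtain F where F: "\<forall>i<m. F i \<in> \<F> (Suc i)"
      "\<forall>i<m. \<forall>j<m. i \<noteq> j \<longrightarrow> (\<forall>l\<in>{1..k}. F i l \<noteq> F j l)"
      using Suc.IH[OF n sub large] by auto
    have "\<exists>x\<in>\<F> 0. \<forall>i<m. \<not> (\<exists>l\<in>{1..k}. x l = F i l)"
    proof (rule exists_avoiding)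
      show "finite (\<F> 0)"
        using fin by simp
      show "m * (k * D) < card (\<F> 0)"
        using degree_bound_arith[OF Suc.prems(1)] Suc.prems(3)[of 0] by (simp add: D_def)
      \<comment> \<open>Each of the \<open>k\<close> vertices of \<open>F i\<close> has degree at
        most \<open>D\<close> in the first family.\<close>
      fix i
      have "{x \<in> \<F> 0. \<exists>l\<in>{1..k}. x l = F i l} = (\<Union>l\<in>{1..k}. {x \<in> \<F> 0. x l = F i l})"
        by auto
      then have "card {x \<in> \<F> 0. \<exists>l\<in>{1..k}. x l = F i l}
          \<le> (\<Sum>l\<in>{1..k}. card {x \<in> \<F> 0. x l = F i l})"
        using card_UN_le[of "{1..k}" "\<lambda>l. {x \<in> \<F> 0. x l = F i l}"] by simp
      also have "\<dots> \<le> k * D"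
        using sum_bounded_above[of "{1..k}" "\<lambda>l. card {x \<in> \<F> 0. x l = F i l}" D] False
        by (auto simp: not_less)
      finally show "card {x \<in> \<F> 0. \<exists>l\<in>{1..k}. x l = F i l} \<le> k * D" .
    qed
    with F show ?thesis by blast
  qed
  then obtain F x where F: "\<forall>i<m. F i \<in> \<F> (Suc i)"
    "\<forall>i<m. \<forall>j<m. i \<noteq> j \<longrightarrow> (\<forall>l\<in>{1..k}. F i l \<noteq> F j l)"
    and x: "x \<in> \<F> 0" "\<forall>i<m. \<forall>l\<in>{1..k}. x l \<noteq> F i l"
    by blast
  show ?case
  \<comment> \<open>\<open>case_nat x F\<close> puts \<open>x\<close> in front of the sequence
    \<open>F\<close>.\<close>
  proof (intro exI[of _ "case_nat x F"] conjI allI impI)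
    fix i assume "i < Suc m"
    then show "case_nat x F i \<in> \<F> i"
      using F(1) x(1) by (cases i) auto
  next
    fix i j assume "i < Suc m" "j < Suc m" "i \<noteq> j"
    then show "\<forall>l\<in>{1..k}. case_nat x F i l \<noteq> case_nat x F j l"
      using F(2) x(2) by (cases i; cases j) (simp_all, metis)
  qed
qed

theorem theorem8:
  fixes n k s :: nat
  assumes "n > 0" and "k > 0" and "s > 0"
    and "n \<ge> k^2 * s^2"
  shows "satisfying n k s (\<lambda>i. min (real s - 1) (real i) * real n ^ (k - 1))"
  unfolding satisfying_def
proof (intro allI impI)
  fix \<F> :: "nat \<Rightarrow> (nat \<Rightarrow> nat) set"
  assume \<F>: "\<forall>i\<in>{1..s}. \<F> i \<subseteq> tuples n k \<and>
    min (real s - 1) (real i) * real n ^ (k - 1) < real (card (\<F> i))"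
  have large: "min (s - 1) (Suc i) * n ^ (k - 1) < card (\<F> (Suc i))" if "i < s" for i
  proof -
    \<comment> \<open>Positivity of \<open>s\<close> makes the real difference agree with the
      truncated \<open>s - 1\<close>.\<close>
    have "min (real s - 1) (real (Suc i)) = real (min (s - 1) (Suc i))"
      using \<open>s > 0\<close> by (simp add: of_nat_min of_nat_diff)
    then have "real (min (s - 1) (Suc i) * n ^ (k - 1)) < real (card (\<F> (Suc i)))"
      using \<F>[rule_format, of "Suc i"] that by simp
    then show ?thesis
      by (simp only: of_nat_less_iff)
  qed
  have sub: "\<F> (Suc i) \<subseteq> tuples n k" if "i < s" for i
    using \<F> that by simp
  obtain F where F: "\<forall>i<s. F i \<in> \<F> (Suc i)"
    "\<forall>i<s. \<forall>j<s. i \<noteq> j \<longrightarrow> (\<forall>l\<in>{1..k}. F i l \<noteq> F j l)"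
    using rainbow_matching[OF assms(4) sub large] by auto
  show "\<exists>F. (\<forall>i\<in>{1..s}. F i \<in> \<F> i) \<and> disjoint_family_on (\<lambda>i. tuple_set k (F i)) {1..s}"
  proof (intro exI[of _ "\<lambda>i. F (i - 1)"] conjI ballI)
    fix i assume "i \<in> {1..s}"
    then show "F (i - 1) \<in> \<F> i"
      using F(1)[rule_format, of "i - 1"] by (cases i) auto
  next
    show "disjoint_family_on (\<lambda>i. tuple_set k (F (i - 1))) {1..s}"
      unfolding disjoint_family_on_def
    proof (intro ballI impI)
      fix i j assume "i \<in> {1..s}" "j \<in> {1..s}" "i \<noteq> j"
      then have "i - 1 < s" "j - 1 < s" "i - 1 \<noteq> j - 1"
        by auto
      then have "\<forall>l\<in>{1..k}. F (i - 1) l \<noteq> F (j - 1) l"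
        using F(2) by blast
      then show "tuple_set k (F (i - 1)) \<inter> tuple_set k (F (j - 1)) = {}"
        by (auto simp: tuple_set_def)
    qed
  qed
qed

end
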